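(* Let $C_n$ be the cycle on $n\ge 4$ vertices. Then $\mathrm{Z}_t(C_n)=4$.
   Context: Zero forcing: given a set $B\subseteq V(G)$ of initially blue vertices (all others white), the color change rule allows a blue vertex $b$ to turn a white vertex $w$ blue if $w$ is the unique white neighbor of $b$. $B$ is a zero forcing set if repeated application of this rule eventually turns all of $V(G)$ blue. A set $B\subseteq V(G)$ with $|B|=m\ge 1$ is a fault tolerant zero forcing set if every subset $F\subseteq B$ with $|F|=m-1$ is a zero forcing set of $G$. $\mathrm{Z}_t(G)$ is the minimum cardinality of a fault tolerant zero forcing set of $G$. *)

theory Defs
  imports "Graph_Theory.Pair_Digraph" "HOL-Library.Extended_Nat"
begin

text \<open>
  A finite simple graph is a \<^locale>\<open>pair_graph\<close>: every undirected edge \<open>uv\<close> is the pair of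
  arcs \<open>(u, v)\<close>, \<open>(v, u)\<close>.  A colouring is represented by its set of blue vertices.
\<close>

definition white_neighbors :: "'a pair_pre_digraph \<Rightarrow> 'a set \<Rightarrow> 'a \<Rightarrow> 'a set" where
  "white_neighbors G S b = {v \<in> pverts G - S. (b, v) \<in> parcs G}"

definition color_change :: "'a pair_pre_digraph \<Rightarrow> 'a set \<Rightarrow> 'a set \<Rightarrow> bool" where
  "color_change G S T \<longleftrightarrow> (\<exists>b\<in>S. \<exists>w. white_neighbors G S b = {w} \<and> T = insert w S)"

definition zero_forcing_set :: "'a pair_pre_digraph \<Rightarrow> 'a set \<Rightarrow> bool" where
  "zero_forcing_set G B \<longleftrightarrow> B \<subseteq> pverts G \<and> (color_change G)\<^sup>*\<^sup>* B (pverts G)"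

definition fault_tolerant_zero_forcing_set :: "'a pair_pre_digraph \<Rightarrow> 'a set \<Rightarrow> bool" where
  "fault_tolerant_zero_forcing_set G B \<longleftrightarrow>
     B \<subseteq> pverts G \<and> card B \<ge> 1 \<and>
     (\<forall>F. F \<subseteq> B \<and> card F = card B - 1 \<longrightarrow> zero_forcing_set G F)"

text \<open>
  Some graphs (e.g. those with an isolated vertex) have no fault tolerant zero forcing set; the
  infimum in \<^typ>\<open>enat\<close> is then \<open>\<infinity>\<close>, and a finite value is always an attained minimum.
\<close>

definition Z_t :: "'a pair_pre_digraph \<Rightarrow> enat" where
  "Z_t G = (INF B \<in> {B. fault_tolerant_zero_forcing_set G B}. enat (card B))"

definition cycle_graph :: "nat \<Rightarrow> nat pair_pre_digraph" where
  "cycle_graph n =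
     \<lparr> pverts = {..<n},
       parcs = {(u, v). u < n \<and> v < n \<and> (v = Suc u mod n \<or> u = Suc v mod n)} \<rparr>"

lemma pair_graph_cycle_graph:
  assumes "n \<ge> 3"
  shows "pair_graph (cycle_graph n)"
proof
  show "finite (parcs (cycle_graph n))"
    by (rule finite_subset[of _ "{..<n} \<times> {..<n}"]) (auto simp: cycle_graph_def)
  show "symmetric (with_proj (cycle_graph n))"
    by (auto simp: symmetric_def cycle_graph_def intro!: symI)
  show "fst e \<noteq> snd e" if "e \<in> parcs (cycle_graph n)" for e
    using that assms by (auto simp: cycle_graph_def mod_Suc split: if_splits)
qed (auto simp: cycle_graph_def)

end

theory Submission
  imports Defs
begin

text \<open>
  Two consecutive blue vertices of a cycle force all the others, and any three of four consecutive
  vertices contain two consecutive ones.  Conversely, a blue set of at most two vertices can perform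
  a force on a cycle only if it consists of two adjacent vertices; since three vertices of \<open>C\<^sub>n\<close>
  with \<open>n \<ge> 4\<close> are not pairwise adjacent, three vertices are never fault tolerant.
\<close>

lemma pverts_cycle_graph [simp]: "pverts (cycle_graph n) = {..<n}"
  by (simp add: cycle_graph_def)

lemma white_neighbors_cycle_graph:
  "white_neighbors (cycle_graph n) S b =
    {v. v < n \<and> v \<notin> S \<and> b < n \<and> (v = Suc b mod n \<or> b = Suc v mod n)}"
  by (auto simp: white_neighbors_def cycle_graph_def)

lemma Suc_mod_inj:
  assumes "Suc u mod n = Suc v mod n" "u < n" "v < n"
  shows "u = v"
  using assms by (auto simp: mod_Suc split: if_splits)

text \<open>The successor map modulo \<open>n\<close> is a single cycle on the residues, so the
  orbit of any one element is everything.\<close>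

lemma Suc_mod_closed_eq_lessThan:
  assumes "F \<subseteq> {..<n}" "k \<in> F" "\<And>u. u \<in> F \<Longrightarrow> Suc u mod n \<in> F"
  shows "F = {..<n}"
proof (intro equalityI assms(1) subsetI)
  fix x assume x: "x \<in> {..<n}"
  have k: "k < n" using assms by auto
  have "(k + i) mod n \<in> F" for i
  proof (induction i)
    case 0
    show ?case using assms k by simp
  next
    case (Suc i)
    show ?case using assms(3)[OF Suc] by (simp add: mod_Suc_eq)
  qed
  \<comment> \<open>Since \<open>k < n\<close>, this offset turns \<open>k + i\<close> into
    \<open>n + x\<close>, which reduces to \<open>x\<close>.\<close>
  from this[of "n - k + x"] show "x \<in> F"
    using x k by simp
qed

text \<open>The only neighbors of \<open>Suc u mod n\<close> are \<open>u\<close> and the vertex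
  after it; as \<open>u\<close> is blue, that next vertex is the unique white one.\<close>

lemma color_change_consecutive:
  assumes "F \<subseteq> {..<n}" "u \<in> F" "Suc u mod n \<in> F" "Suc (Suc u mod n) mod n \<notin> F"
  shows "color_change (cycle_graph n) F (insert (Suc (Suc u mod n) mod n) F)"
proof -
  have u: "u < n" using assms by auto
  have "white_neighbors (cycle_graph n) F (Suc u mod n) = {Suc (Suc u mod n) mod n}"
    using assms u Suc_mod_inj[of u n] by (auto simp: white_neighbors_cycle_graph)
  then show ?thesis
    unfolding color_change_def using assms(3) by blast
qed

text \<open>Induction on the number of white vertices: each force adds a vertex and keeps the blue
  pair at \<open>k\<close>.\<close>

lemma zero_forcing_set_cycle_consecutive:
  assumes "F \<subseteq> {..<n}" "k \<in> F" "Suc k mod n \<in> F"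
  shows "zero_forcing_set (cycle_graph n) F"
  using assms
proof (induction "card ({..<n} - F)" arbitrary: F rule: less_induct)
  case less
  show ?case
  proof (cases "F = {..<n}")
    case True
    then show ?thesis by (simp add: zero_forcing_set_def)
  next
    case False
    obtain u where u: "u \<in> F" "Suc u mod n \<in> F" "Suc (Suc u mod n) mod n \<notin> F"
    proof (rule ccontr)
      assume "\<not> thesis"
      with that have closed: "Suc (Suc u mod n) mod n \<in> F" if "u \<in> F" "Suc u mod n \<in> F" for u
        using that by blast
      \<comment> \<open>If no blue pair is followed by a white vertex, the starting points of blue
        pairs are closed under successor, so every vertex is blue.\<close>
      have "{u \<in> F. Suc u mod n \<in> F} = {..<n}"
        by (rule Suc_mod_closed_eq_lessThan[of _ _ k]) (use less.prems closed in auto)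
      with less.prems False show False by auto
    qed
    let ?w = "Suc (Suc u mod n) mod n"
    have w: "?w < n" using u less.prems by auto
    have "card ({..<n} - insert ?w F) < card ({..<n} - F)"
      using u w by (intro psubset_card_mono) auto
    then have "zero_forcing_set (cycle_graph n) (insert ?w F)"
      using less.hyps[of "insert ?w F"] less.prems w by auto
    with color_change_consecutive[OF less.prems(1) u] less.prems(1) show ?thesis
      by (auto simp: zero_forcing_set_def intro: converse_rtranclp_into_rtranclp)
  qed
qed

text \<open>Only the first force matters. It must exist because \<open>F\<close> has fewer than
  \<open>n\<close> vertices, and the forcing vertex has two distinct neighbors of which just one is
  white; the other is therefore in \<open>F\<close>.\<close>

lemma small_zero_forcing_set_cycle:
  assumes "n \<ge> 3" "zero_forcing_set (cycle_graph n) F" "card F \<le> 2"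
  obtains u where "F = {u, Suc u mod n}" "card F = 2"
proof -
  have sub: "F \<subseteq> {..<n}" and steps: "(color_change (cycle_graph n))\<^sup>*\<^sup>* F {..<n}"
    using assms by (auto simp: zero_forcing_set_def)
  have fin: "finite F" using sub finite_subset by blast
  have "F \<noteq> {..<n}" using assms by auto
  with steps obtain T where "color_change (cycle_graph n) F T"
    by (meson converse_rtranclpE)
  then obtain b w where b: "b \<in> F" and w: "white_neighbors (cycle_graph n) F b = {w}"
    unfolding color_change_def by blast
  have bn: "b < n" using b sub by auto
  \<comment> \<open>\<open>p\<close> is the predecessor of \<open>b\<close> on the cycle;
    \<open>n \<ge> 3\<close> makes \<open>p\<close>, \<open>b\<close> and the successor of
    \<open>b\<close> distinct.\<close>
  define p where "p = (if b = 0 then n - 1 else b - 1)"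
  have p: "p < n" "Suc p mod n = b" "p \<noteq> Suc b mod n" "p \<noteq> b" "Suc b mod n \<noteq> b"
    using bn assms(1) by (auto simp: p_def mod_Suc split: if_splits)
  have "p \<in> F \<or> Suc b mod n \<in> F"
  proof (rule ccontr)
    assume "\<not> ?thesis"
    then have "p \<in> white_neighbors (cycle_graph n) F b"
      "Suc b mod n \<in> white_neighbors (cycle_graph n) F b"
      using p bn by (auto simp: white_neighbors_cycle_graph)
    with w p show False by auto
  qed
  then obtain u where u: "{u, Suc u mod n} \<subseteq> F" "card {u, Suc u mod n} = 2"
  proof (elim disjE)
    assume "p \<in> F"
    then show thesis using that[of p] p b by simp
  next
    assume "Suc b mod n \<in> F"
    then show thesis using that[of b] p b by simp
  qed
  then have "F = {u, Suc u mod n}"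
    using card_seteq[OF fin u(1)] assms(3) by simp
  with u that show thesis by simp
qed

lemma fault_tolerant_zero_forcing_set_cycle_four:
  assumes "n \<ge> 4"
  shows "fault_tolerant_zero_forcing_set (cycle_graph n) {..<4}"
  unfolding fault_tolerant_zero_forcing_set_def
proof (intro conjI allI impI)
  fix F :: "nat set"
  assume "F \<subseteq> {..<4} \<and> card F = card {..<4::nat} - 1"
  then have F: "F \<subseteq> {..<4}" "card F = 3" by auto
  have "\<exists>k \<in> F. Suc k \<in> F"
  proof (rule ccontr)
    assume "\<not> ?thesis"
    then have none: "Suc k \<notin> F" if "k \<in> F" for k using that by blast
    \<comment> \<open>Without consecutive elements, \<open>F\<close> meets each of {0, 1} and {2, 3}
      at most once; \<open>a\<close> and \<open>b\<close> are the only candidates there.\<close>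
    define a b :: nat where "a = (if 0 \<in> F then 0 else 1)" and "b = (if 2 \<in> F then 2 else 3)"
    have "x = a \<or> x = b" if "x \<in> F" for x
    proof -
      have "x = 0 \<or> x = 1 \<or> x = 2 \<or> x = 3" using F(1) that by auto
      then show ?thesis
        using that none[of 0] none[of 2] by (auto simp: a_def b_def)
    qed
    then have "F \<subseteq> {a, b}" by blast
    then have "card F \<le> card {a, b}" by (intro card_mono) auto
    also have "\<dots> \<le> 2" by (simp add: card_insert_if)
    finally show False using F by simp
  qed
  then obtain k where k: "k \<in> F" "Suc k \<in> F" by blast
  moreover have "Suc k < n" using k F assms by force
  ultimately show "zero_forcing_set (cycle_graph n) F"
    using F assms by (intro zero_forcing_set_cycle_consecutive[of _ _ k]) auto
qed (use assms in auto)

lemma card_fault_tolerant_zero_forcing_set_cycle_ge: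
  assumes "n \<ge> 4" "fault_tolerant_zero_forcing_set (cycle_graph n) B"
  shows "card B \<ge> 4"
proof (rule ccontr)
  assume small: "\<not> card B \<ge> 4"
  have zf: "zero_forcing_set (cycle_graph n) F" if "F \<subseteq> B" "card F = card B - 1" for F
    using assms that unfolding fault_tolerant_zero_forcing_set_def by blast
  have B: "B \<subseteq> {..<n}" "card B \<ge> 1"
    using assms by (auto simp: fault_tolerant_zero_forcing_set_def)
  have pair: "(\<exists>u. F = {u, Suc u mod n}) \<and> card F = 2" if "F \<subseteq> B" "card F = card B - 1" for F
  proof (rule small_zero_forcing_set_cycle[OF _ zf[OF that]])
    show "n \<ge> 3" "card F \<le> 2" using assms(1) that(2) small by auto
  qed blast
  obtain F where F: "F \<subseteq> B" "card F = card B - 1"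
    using obtain_subset_with_card_n[of "card B - 1" B] by auto
  \<comment> \<open>The exact size 2 in \<open>pair\<close> also rules out \<open>B\<close> with one
    or two elements.\<close>
  have "card B = 3" using pair[OF F] F(2) by linarith
  then obtain a b c where abc: "B = {a, b, c}" "a \<noteq> b" "b \<noteq> c" "a \<noteq> c"
    by (auto simp: card_3_iff)
  \<comment> \<open>Adjacency is written without \<open>mod\<close>, with the wrap-around edge as
    explicit cases, so that excluding a triangle for \<open>n \<ge> 4\<close> becomes linear
    arithmetic.\<close>
  have adj: "Suc x = y \<or> Suc y = x \<or> (x = 0 \<and> Suc y = n) \<or> (y = 0 \<and> Suc x = n)"
    if xy: "x \<in> B" "y \<in> B" "x \<noteq> y" for x y
  proof -
    have "{x, y} \<subseteq> B" "card {x, y} = card B - 1" using xy \<open>card B = 3\<close> by simp_all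
    from pair[OF this] obtain u where "{x, y} = {u, Suc u mod n}" by blast
    then have "y = Suc x mod n \<or> x = Suc y mod n" by (metis doubleton_eq_iff)
    moreover have "x < n" "y < n" using B xy by auto
    ultimately show ?thesis by (auto simp: mod_Suc split: if_splits)
  qed
  from adj[of a b] adj[of b c] adj[of a c] abc assms(1) show False
    by simp linarith
qed

theorem theorem3p3:
  fixes n :: nat
  assumes "n \<ge> 4"
  shows "Z_t (cycle_graph n) = 4"
proof (rule antisym)
  have "Z_t (cycle_graph n) \<le> enat (card {..<4::nat})"
    unfolding Z_t_def
    using fault_tolerant_zero_forcing_set_cycle_four[OF assms] by (intro INF_lower) simp
  then show "Z_t (cycle_graph n) \<le> 4" by (simp add: numeral_eq_enat)
  show "4 \<le> Z_t (cycle_graph n)"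
    unfolding Z_t_def
    using card_fault_tolerant_zero_forcing_set_cycle_ge[OF assms]
    by (intro INF_greatest) (simp add: numeral_eq_enat)
qed

end
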